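(* Let $c \in \mathbb{N}$. Then there exists a constant $C = C(c) \in \mathbb{N}$, depending only on $c$, such that for all $n \in \mathbb{N}$ and all $c$-quasihomomorphisms $f: \mathbb{Z} \to \mathbb{Q}^n$ we have \[ \forall x \in \mathbb{Z}: \qquad w_H\big(f(x) - x\cdot f(1)\big) \leq C. \] Moreover, one can take $C = 28c$.
   Context: For an abelian group $(Q,+)$ and $v \in Q^n$, the Hamming weight $w_H(v)$ is the number of nonzero entries of $v$. A function $f: \mathbb{Z} \to Q^n$ is a $c$-quasihomomorphism if $w_H\big(f(x+y) - f(x) - f(y)\big) \leq c$ for all $x,y \in \mathbb{Z}$. *)

theory Defs
  imports "Jordan_Normal_Form.Matrix"
begin

definition hamming_weight :: "'a::zero vec \<Rightarrow> nat" where
  "hamming_weight v = card {i. i < dim_vec v \<and> v $ i \<noteq> 0}"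

(* The group Q^n is carrier_vec n over an abelian group type, so that n is an ordinary
   variable that can be quantified inside a formula. *)
definition quasihomomorphism :: "nat \<Rightarrow> nat \<Rightarrow> (int \<Rightarrow> 'a::ab_group_add vec) \<Rightarrow> bool" where
  "quasihomomorphism c n f \<longleftrightarrow>
     f \<in> UNIV \<rightarrow> carrier_vec n \<and>
     (\<forall>x y. hamming_weight (f (x + y) - f x - f y) \<le> c)"

end

theory Submission
  imports Defs
begin

text \<open>
  The argument is a linearity test applied to each coordinate \<open>g\<close> separately. For \<open>a \<ge> 0\<close> and
  \<open>N = a + 4\<close>, suppose that \<open>g\<close> is additive on most pairs of \<open>[0, 2N) \<times> [0, N)\<close>. For
  \<open>k \<le> a\<close>, the identity \<open>g (k + y) + g z = g (k + y + z) = g (k + z) + g y\<close>, valid for most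
  \<open>y, z\<close>, shows that \<open>y \<mapsto> g (k + y) - g y\<close> takes one value \<open>h k\<close> for more than three quarters
  of all \<open>y < N\<close>. Hence \<open>h (k + 1) = h k + h 1\<close>, so \<open>h a = a * h 1\<close>. If moreover
  \<open>g (a + y) = g a + g y\<close> and \<open>g (1 + y) = g 1 + g y\<close> for at least half of all \<open>y\<close>, then
  \<open>g a = h a\<close> and \<open>g 1 = h 1\<close>. By double counting, the three requirements fail for at most
  \<open>16c\<close>, \<open>2c\<close> and \<open>2c\<close> coordinates. Passing to negative arguments costs another \<open>2c\<close>.
\<close>

text \<open>Double counting of the pairs with \<open>R i p\<close>: there are at most
  \<open>card P * c\<close> of them, and each counted \<open>i\<close> lies in at least
  \<open>card P / m\<close>. Later \<open>R i p\<close> says that coordinate \<open>i\<close> fails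
  additivity at \<open>p\<close>.\<close>

lemma card_frequent_le:
  assumes "finite I" "finite P" "P \<noteq> {}"
    and le: "\<And>p. p \<in> P \<Longrightarrow> card {i \<in> I. R i p} \<le> c"
  shows "card {i \<in> I. card P \<le> m * card {p \<in> P. R i p}} \<le> m * c"
proof -
  let ?J = "{i \<in> I. card P \<le> m * card {p \<in> P. R i p}}"
  have "card ?J * card P = (\<Sum>i\<in>?J. card P)" by simp
  also have "\<dots> \<le> (\<Sum>i\<in>?J. m * card {p \<in> P. R i p})" by (intro sum_mono) auto
  also have "\<dots> \<le> (\<Sum>i\<in>I. m * card {p \<in> P. R i p})"
    using assms by (intro sum_mono2) auto
  also have "\<dots> = m * (\<Sum>i\<in>I. card {p \<in> P. R i p})" by (simp add: sum_distrib_left)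
  also have "(\<Sum>i\<in>I. card {p \<in> P. R i p}) = (\<Sum>p\<in>P. card {i \<in> I. R i p})"
    using sum_multicount_gen[of I P "\<lambda>i p. R i p" "\<lambda>p. card {i \<in> I. R i p}"] assms by auto
  also have "m * \<dots> \<le> m * (\<Sum>p\<in>P. c)" using le by (intro mult_left_mono sum_mono) auto
  finally have "card ?J * card P \<le> (m * c) * card P" by (simp add: mult_ac)
  moreover have "card P > 0" using assms by (simp add: card_gt_0_iff)
  ultimately show ?thesis by (simp only: mult_le_cancel2)
qed

text \<open>Some \<open>d y\<close> works as the value: if each were missed by at least
  \<open>N / m\<close> of the \<open>z\<close>, summing over the rows \<open>y\<close> would give at
  least \<open>N * N / m\<close> disagreeing pairs.\<close>

lemma ex_majority_value:
  fixes d :: "nat \<Rightarrow> 'a"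
  assumes "m * card {(y, z) \<in> {..<N} \<times> {..<N}. d y \<noteq> d z} < N * N"
  shows "\<exists>v. m * card {y \<in> {..<N}. d y \<noteq> v} < N"
proof (rule ccontr)
  assume "\<not> ?thesis"
  then have ge: "N \<le> m * card {z \<in> {..<N}. d y \<noteq> d z}" for y
    by (simp add: not_less eq_commute[of "d y"])
  have "{(y, z) \<in> {..<N} \<times> {..<N}. d y \<noteq> d z} = (SIGMA y:{..<N}. {z \<in> {..<N}. d y \<noteq> d z})"
    by auto
  then have "card {(y, z) \<in> {..<N} \<times> {..<N}. d y \<noteq> d z}
      = (\<Sum>y<N. card {z \<in> {..<N}. d y \<noteq> d z})"
    by simp
  moreover have "(\<Sum>y<N. N) \<le> (\<Sum>y<N. m * card {z \<in> {..<N}. d y \<noteq> d z})"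
    using ge by (intro sum_mono)
  ultimately show False using assms by (simp add: sum_distrib_left)
qed

lemma ex_avoiding3:
  assumes "finite X" "card {x \<in> X. P x} + card {x \<in> X. Q x} + card {x \<in> X. R x} < card X"
  shows "\<exists>x\<in>X. \<not> P x \<and> \<not> Q x \<and> \<not> R x"
proof (rule ccontr)
  assume "\<not> ?thesis"
  then have "X = {x \<in> X. P x} \<union> {x \<in> X. Q x} \<union> {x \<in> X. R x}" by auto
  then have "card X \<le> card {x \<in> X. P x} + card {x \<in> X. Q x} + card {x \<in> X. R x}"
    by (metis (no_types, lifting) add_le_mono1 card_Un_le le_trans)
  with assms show False by simp
qed

text \<open>The rectangle has a side of length \<open>2 * N\<close> because \<open>k + y\<close>
  ranges below \<open>2 * N\<close>. Each disagreement of two differences injects into the failures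
  of additivity in one of two ways, so \<open>card ?D\<close> is at most \<open>2 * card ?B\<close>,
  which is below \<open>N * N / 4\<close>.\<close>

lemma ex_majority_difference:
  fixes g :: "nat \<Rightarrow> 'a::ab_group_add"
  assumes "k \<le> N"
    and few: "16 * card {(u, v) \<in> {..<2 * N} \<times> {..<N}. g (u + v) \<noteq> g u + g v} < 2 * N * N"
  shows "\<exists>v. 4 * card {y \<in> {..<N}. g (k + y) - g y \<noteq> v} < N"
proof -
  let ?B = "{(u, v) \<in> {..<2 * N} \<times> {..<N}. g (u + v) \<noteq> g u + g v}"
  let ?D = "{(y, z) \<in> {..<N} \<times> {..<N}. g (k + y) - g y \<noteq> g (k + z) - g z}"
  let ?L = "{(y, z) \<in> {..<N} \<times> {..<N}. (k + y, z) \<in> ?B}"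
  let ?R = "{(y, z) \<in> {..<N} \<times> {..<N}. (k + z, y) \<in> ?B}"
  have fin: "finite ?B" by (rule finite_subset[of _ "{..<2 * N} \<times> {..<N}"]) auto
  have "?D \<subseteq> ?L \<union> ?R"
  proof
    fix p assume "p \<in> ?D"
    then obtain y z where p: "p = (y, z)"
      and yz: "y < N" "z < N" "g (k + y) - g y \<noteq> g (k + z) - g z"
      by auto
    have "g (k + y + z) \<noteq> g (k + y) + g z \<or> g (k + z + y) \<noteq> g (k + z) + g y"
    proof (rule ccontr)
      assume "\<not> ?thesis"
      moreover have "k + z + y = k + y + z" by simp
      ultimately have "g (k + y) + g z = g (k + z) + g y" by metis
      then have "g (k + y) = g (k + z) + g y - g z" by (simp add: eq_diff_eq)
      with yz(3) show False by simp
    qed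
    with yz \<open>k \<le> N\<close> show "p \<in> ?L \<union> ?R" unfolding p by auto
  qed
  moreover have "finite (?L \<union> ?R)"
    by (rule finite_subset[of _ "{..<N} \<times> {..<N}"]) auto
  ultimately have "card ?D \<le> card ?L + card ?R"
    by (meson card_Un_le card_mono le_trans)
  moreover have "card ?L \<le> card ?B"
    by (rule card_inj_on_le[where f = "\<lambda>(y, z). (k + y, z)", OF _ _ fin]) (auto simp: inj_on_def)
  moreover have "card ?R \<le> card ?B"
    by (rule card_inj_on_le[where f = "\<lambda>(y, z). (k + z, y)", OF _ _ fin]) (auto simp: inj_on_def)
  ultimately have "4 * card ?D < N * N" using few by simp
  then show ?thesis by (rule ex_majority_value)
qed

text \<open>Telescoping: the difference of \<open>g\<close> over a step of \<open>Suc k\<close> from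
  \<open>y\<close> is the step of 1 from \<open>y\<close> plus the step of \<open>k\<close> from
  \<open>Suc y\<close>. One \<open>y\<close> typical for all three transfers this to
  \<open>h\<close>.\<close>

lemma majority_differences_linear:
  fixes g :: "nat \<Rightarrow> 'a::ring_1"
  assumes "4 \<le> N"
    and h: "\<And>k. k \<le> a \<Longrightarrow> 4 * card {y \<in> {..<N}. g (k + y) - g y \<noteq> h k} < N"
    and "1 \<le> a" "k \<le> a"
  shows "h k = of_nat k * h 1"
  using \<open>k \<le> a\<close>
proof (induction k)
  case 0
  have "h 0 = 0"
  proof (rule ccontr)
    assume "h 0 \<noteq> 0"
    then have "{y \<in> {..<N}. g (0 + y) - g y \<noteq> h 0} = {..<N}" by auto
    with h[OF le0] show False by simp
  qed
  then show ?case by simp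
next
  case (Suc k)
  let ?E = "\<lambda>k y. g (k + y) - g y \<noteq> h k"
  \<comment> \<open>Stopping at \<open>N - 1\<close> keeps \<open>Suc y\<close> below
    \<open>N\<close>. Each exceptional set has at most \<open>(N - 1) / 4\<close> elements, so three
    of them cannot cover \<open>?X\<close>.\<close>
  let ?X = "{..<N - 1}"
  have le: "card {y \<in> ?X. ?E j y} \<le> card {y \<in> {..<N}. ?E j y}" for j
    by (rule card_mono) auto
  have shift: "card {y \<in> ?X. ?E k (Suc y)} \<le> card {y \<in> {..<N}. ?E k y}"
    by (rule card_inj_on_le[where f = Suc]) auto
  have "card {y \<in> ?X. ?E (Suc k) y} + card {y \<in> ?X. ?E 1 y} + card {y \<in> ?X. ?E k (Suc y)}
      < card ?X"
    using le[of "Suc k"] le[of 1] shift h[OF Suc.prems] h[OF \<open>1 \<le> a\<close>] h[OF Suc_leD[OF Suc.prems]]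
      \<open>4 \<le> N\<close>
    unfolding card_lessThan by linarith
  then obtain y where y: "\<not> ?E (Suc k) y" "\<not> ?E 1 y" "\<not> ?E k (Suc y)"
    using ex_avoiding3[of ?X "?E (Suc k)" "?E 1" "\<lambda>y. ?E k (Suc y)"] by auto
  then have "h (Suc k) = h k + h 1" by (auto simp: algebra_simps)
  with Suc show ?case by (simp add: algebra_simps)
qed

lemma mostly_additive_imp_linear_at:
  fixes g :: "nat \<Rightarrow> 'a::ring_1"
  assumes "4 \<le> N" "a \<le> N" "1 \<le> a"
    and pairs: "16 * card {(u, v) \<in> {..<2 * N} \<times> {..<N}. g (u + v) \<noteq> g u + g v} < 2 * N * N"
    and at_a: "2 * card {y \<in> {..<N}. g (a + y) \<noteq> g a + g y} < N"
    and at_1: "2 * card {y \<in> {..<N}. g (1 + y) \<noteq> g 1 + g y} < N"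
  shows "g a = of_nat a * g 1"
proof -
  have "\<forall>k. \<exists>v. k \<le> a \<longrightarrow> 4 * card {y \<in> {..<N}. g (k + y) - g y \<noteq> v} < N"
    using ex_majority_difference[OF _ pairs] \<open>a \<le> N\<close> by (meson le_trans)
  from choice[OF this]
  obtain h where h: "4 * card {y \<in> {..<N}. g (k + y) - g y \<noteq> h k} < N" if "k \<le> a" for k
    by blast
  \<comment> \<open>Fewer than \<open>N / 4\<close> and fewer than \<open>N / 2\<close> exceptions
    leave a common good \<open>y\<close>, where the difference equals both \<open>h k\<close> and
    \<open>g k\<close>.\<close>
  have eq: "g k = h k"
    if "k \<le> a" "2 * card {y \<in> {..<N}. g (k + y) \<noteq> g k + g y} < N" for k
  proof -
    have "\<exists>y\<in>{..<N}. g (k + y) - g y = h k \<and> g (k + y) = g k + g y"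
      using ex_avoiding3[of "{..<N}" "\<lambda>y. g (k + y) - g y \<noteq> h k"
          "\<lambda>y. g (k + y) \<noteq> g k + g y" "\<lambda>_. False"] h[OF that(1)] that(2) by auto
    then show ?thesis by auto
  qed
  show ?thesis
    using majority_differences_linear[OF \<open>4 \<le> N\<close> h \<open>1 \<le> a\<close> order_refl] eq[OF order_refl at_a]
      eq[OF \<open>1 \<le> a\<close> at_1] by simp
qed

lemma card_nonlinear_nat_le:
  fixes f :: "'i \<Rightarrow> nat \<Rightarrow> 'a::ring_1"
  assumes "finite I"
    and le: "\<And>x y. card {i \<in> I. f i (x + y) \<noteq> f i x + f i y} \<le> c"
    and "1 \<le> a"
  shows "card {i \<in> I. f i a \<noteq> of_nat a * f i 1} \<le> 20 * c"
proof -
  \<comment> \<open>This choice meets both \<open>a \<le> N\<close> and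
    \<open>4 \<le> N\<close>.\<close>
  define N where "N = a + 4"
  define R where "R = (\<lambda>i (x, y). f i (x + y) \<noteq> f i x + f i y)"
  let ?P = "{..<2 * N} \<times> {..<N}"
  let ?S = "{i \<in> I. card ?P \<le> 16 * card {p \<in> ?P. R i p}}"
  let ?T = "\<lambda>k. {i \<in> I. card {..<N} \<le> 2 * card {y \<in> {..<N}. R i (k, y)}}"
  have R: "card {i \<in> I. R i p} \<le> c" for p
    using le by (cases p) (simp add: R_def)
  have "N > 0" by (simp add: N_def)
  then have S: "card ?S \<le> 16 * c" and T: "card (?T k) \<le> 2 * c" for k
    using card_frequent_le[of I ?P R c 16] card_frequent_le[of I "{..<N}" "\<lambda>i y. R i (k, y)" c 2]
      \<open>finite I\<close> R by (simp_all add: lessThan_empty_iff)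
  have "{i \<in> I. f i a \<noteq> of_nat a * f i 1} \<subseteq> ?S \<union> ?T a \<union> ?T 1"
  proof (rule subsetI, rule ccontr)
    fix i assume i: "i \<in> {i \<in> I. f i a \<noteq> of_nat a * f i 1}" "i \<notin> ?S \<union> ?T a \<union> ?T 1"
    have eq: "{(u, v) \<in> ?P. f i (u + v) \<noteq> f i u + f i v} = {p \<in> ?P. R i p}"
      by (auto simp: R_def)
    have "f i a = of_nat a * f i 1"
      using i \<open>1 \<le> a\<close>
      by (intro mostly_additive_imp_linear_at[of N], unfold eq) (auto simp: N_def R_def)
    with i show False by simp
  qed
  then have "card {i \<in> I. f i a \<noteq> of_nat a * f i 1} \<le> card (?S \<union> ?T a \<union> ?T 1)"
    using \<open>finite I\<close> by (intro card_mono) auto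
  also have "\<dots> \<le> card ?S + card (?T a) + card (?T 1)"
    by (meson add_le_mono1 card_Un_le le_trans)
  finally show ?thesis using S T[of a] T[of 1] by linarith
qed

lemma card_nonlinear_le:
  fixes f :: "'i \<Rightarrow> int \<Rightarrow> 'a::ring_1"
  assumes "finite I"
    and le: "\<And>x y. card {i \<in> I. f i (x + y) \<noteq> f i x + f i y} \<le> c"
  shows "card {i \<in> I. f i x \<noteq> of_int x * f i 1} \<le> 22 * c"
proof -
  let ?V = "\<lambda>x y. {i \<in> I. f i (x + y) \<noteq> f i x + f i y}"
  let ?W = "\<lambda>x. {i \<in> I. f i x \<noteq> of_int x * f i 1}"
  have pos: "card (?W (int a)) \<le> 20 * c" if "1 \<le> a" for a
    using card_nonlinear_nat_le[of I "\<lambda>i k. f i (int k)" c a] assms that by simp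
  \<comment> \<open>A nonzero \<open>f i 0\<close> is itself a failure of additivity at (0,
    0).\<close>
  have zero: "?W 0 \<subseteq> ?V 0 0" by auto
  consider "x = 0" | a where "1 \<le> a" "x = int a" | a where "1 \<le> a" "x = - int a"
    by (cases x rule: int_cases2; force)
  then show ?thesis
  proof cases
    case 1
    have "card (?W 0) \<le> card (?V 0 0)" using zero \<open>finite I\<close> by (intro card_mono) auto
    then show ?thesis using le[of 0 0] unfolding 1 by linarith
  next
    case 2
    then show ?thesis using pos[of a] by simp
  next
    case 3
    \<comment> \<open>Outside the last two sets \<open>f i (int a) + f i x = f i 0 = 0\<close>, so
      linearity at \<open>int a\<close> passes to its negative.\<close>
    have "?W x \<subseteq> ?W (int a) \<union> ?V (int a) x \<union> ?V 0 0"
      unfolding 3 by (auto simp: eq_neg_iff_add_eq_0 add.commute)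
    then have "card (?W x) \<le> card (?W (int a) \<union> ?V (int a) x \<union> ?V 0 0)"
      using \<open>finite I\<close> by (intro card_mono) auto
    also have "\<dots> \<le> card (?W (int a)) + card (?V (int a) x) + card (?V 0 0)"
      by (meson add_le_mono1 card_Un_le le_trans)
    finally show ?thesis using pos[OF 3(1)] le[of "int a" x] le[of 0 0] by linarith
  qed
qed

lemma quasihomomorphism_dist_linear_le:
  fixes f :: "int \<Rightarrow> 'a::ring_1 vec"
  assumes "quasihomomorphism c n f"
  shows "hamming_weight (f x - of_int x \<cdot>\<^sub>v f 1) \<le> 22 * c"
proof -
  have dim [simp]: "dim_vec (f x) = n" for x
    using assms by (auto simp: quasihomomorphism_def Pi_iff)
  have "card {i \<in> {..<n}. f (x + y) $ i \<noteq> f x $ i + f y $ i} \<le> c" for x y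
  proof -
    have "{i \<in> {..<n}. f (x + y) $ i \<noteq> f x $ i + f y $ i}
        = {i. i < dim_vec (f (x + y) - f x - f y) \<and> (f (x + y) - f x - f y) $ i \<noteq> 0}"
      by (auto simp: algebra_simps)
    then show ?thesis
      using assms by (simp add: quasihomomorphism_def hamming_weight_def)
  qed
  then have "card {i \<in> {..<n}. f x $ i \<noteq> of_int x * f 1 $ i} \<le> 22 * c"
    by (intro card_nonlinear_le[where f = "\<lambda>i x. f x $ i"]) auto
  moreover have "{i \<in> {..<n}. f x $ i \<noteq> of_int x * f 1 $ i}
      = {i. i < dim_vec (f x - of_int x \<cdot>\<^sub>v f 1) \<and> (f x - of_int x \<cdot>\<^sub>v f 1) $ i \<noteq> 0}"
    by auto
  ultimately show ?thesis by (simp add: hamming_weight_def)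
qed

theorem mainTheorem1:
  fixes c :: nat
  shows "(\<exists>C::nat. \<forall>(n::nat) (f :: int \<Rightarrow> rat vec). quasihomomorphism c n f \<longrightarrow>
            (\<forall>x::int. hamming_weight (f x - of_int x \<cdot>\<^sub>v f 1) \<le> C)) \<and>
         (\<forall>(n::nat) (f :: int \<Rightarrow> rat vec). quasihomomorphism c n f \<longrightarrow>
            (\<forall>x::int. hamming_weight (f x - of_int x \<cdot>\<^sub>v f 1) \<le> 28 * c))"
proof -
  \<comment> \<open>The coordinatewise count gives the smaller constant 22 = 16 + 2 + 2 + 2.\<close>
  have "hamming_weight (f x - of_int x \<cdot>\<^sub>v f 1) \<le> 28 * c"
    if "quasihomomorphism c n f" for n x and f :: "int \<Rightarrow> rat vec"
    using quasihomomorphism_dist_linear_le[OF that, of x] by linarith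
  then show ?thesis by blast
qed

end
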